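(* Let $X$ be a geodesic metric space. Then affine functions on $X$ separate points of $X$ (i.e. for every pair of points $x\neq\bar x$ in $X$ there is an affine function $f:X\to\mathbb{R}$ with $f(x)\neq f(\bar x)$) if and only if $X$ is isometric to a convex subset of a normed vector space whose norm is strictly convex.
   Context: A geodesic in a metric space is an isometric embedding of an interval; $X$ is geodesic if any two points are joined by a geodesic. A function $f:X\to\mathbb{R}$ is called affine if for every arclength parametrized geodesic $\gamma$ in $X$ there are numbers $a,b$ (depending on $\gamma$) with $f(\gamma(t))=at+b$ for all $t$. A norm $\|\cdot\|$ on a vector space is strictly convex if $\|v+w\|<\|v\|+\|w\|$ for all linearly independent $v,w$. A subset of a vector space is convex if it contains the linear segment between any two of its points. *)

theory Defs
  imports "HOL-Analysis.Analysis" "HOL-Analysis.Finite_Function_Topology"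
begin

definition geodesic_on :: "real set \<Rightarrow> (real \<Rightarrow> 'a::metric_space) \<Rightarrow> bool" where
  "geodesic_on I \<gamma> \<longleftrightarrow> is_interval I \<and> (\<forall>s\<in>I. \<forall>t\<in>I. dist (\<gamma> s) (\<gamma> t) = \<bar>s - t\<bar>)"

definition geodesic_space :: "'a::metric_space itself \<Rightarrow> bool" where
  "geodesic_space _ \<longleftrightarrow> (\<forall>x y::'a. \<exists>\<gamma>. geodesic_on {0..dist x y} \<gamma> \<and> \<gamma> 0 = x \<and> \<gamma> (dist x y) = y)"

definition affine_fun :: "('a::metric_space \<Rightarrow> real) \<Rightarrow> bool" where
  "affine_fun f \<longleftrightarrow> (\<forall>I \<gamma>. geodesic_on I (\<gamma> :: real \<Rightarrow> 'a) \<longrightarrow>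
      (\<exists>a b. \<forall>t\<in>I. f (\<gamma> t) = a * t + b))"

definition affine_separates_points :: "'a::metric_space itself \<Rightarrow> bool" where
  "affine_separates_points _ \<longleftrightarrow>
     (\<forall>x y::'a. x \<noteq> y \<longrightarrow> (\<exists>f. affine_fun f \<and> f x \<noteq> f y))"

definition normed_space_on :: "'v::real_vector set \<Rightarrow> ('v \<Rightarrow> real) \<Rightarrow> bool" where
  "normed_space_on V N \<longleftrightarrow> subspace V \<and>
     (\<forall>v\<in>V. N v \<ge> 0 \<and> (N v = 0 \<longleftrightarrow> v = 0)) \<and>
     (\<forall>c. \<forall>v\<in>V. N (c *\<^sub>R v) = \<bar>c\<bar> * N v) \<and>
     (\<forall>v\<in>V. \<forall>w\<in>V. N (v + w) \<le> N v + N w)"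

definition strictly_convex_norm_on :: "'v::real_vector set \<Rightarrow> ('v \<Rightarrow> real) \<Rightarrow> bool" where
  "strictly_convex_norm_on V N \<longleftrightarrow>
     (\<forall>v\<in>V. \<forall>w\<in>V. (\<forall>a b::real. a *\<^sub>R v + b *\<^sub>R w = 0 \<longrightarrow> a = 0 \<and> b = 0)
        \<longrightarrow> N (v + w) < N v + N w)"

definition isometric_to_convex_subset ::
  "'a::metric_space itself \<Rightarrow> 'v::real_vector set \<Rightarrow> ('v \<Rightarrow> real) \<Rightarrow> bool" where
  "isometric_to_convex_subset _ V N \<longleftrightarrow>
     (\<exists>g :: 'a \<Rightarrow> 'v. range g \<subseteq> V \<and> convex (range g) \<and>
        (\<forall>x y. N (g x - g y) = dist x y))"

end

theory Submission
  imports Defs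
begin

text \<open>
  Suppose that affine functions separate points. The quotient of the free vector space over \<open>X\<close> by
  the common kernel of the linear extensions of the affine functions contains a copy of \<open>X\<close> in which
  geodesics are linear segments, traversed at constant speed. The metric comes from a norm once it
  is invariant under translations, that is, once opposite sides of a parallelogram have equal length.
  Parametrize two opposite sides over \<open>[0,1]\<close> and let \<open>D a b\<close> be the distance from the point \<open>a\<close>
  on the first to the point \<open>b\<close> on the second. The triangle inequality gives
  \<open>D a b \<le> (D a (b + h) + D (a + h) b) / 2\<close> for \<open>h\<close> of either sign, and a law of large numbers
  for the associated random walk shows that \<open>D\<close> is constant on the diagonal. Strict convexity holds
  because a point that gives equality in the triangle inequality lies on a geodesic.

  Conversely, equality in the triangle inequality of a strictly convex norm forces geodesics to be
  linear, so linear functionals restrict to affine functions.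
\<close>

section \<open>Random walk in the unit square and the end values on the diagonal\<close>

text \<open>Iterating the hypothesis \<open>mid\<close> bounds \<open>D a b\<close> by the expectation of \<open>D\<close> at the endpoint of
  a random walk that adds \<open>h\<close> to one of the two coordinates, chosen by a fair coin. The last summand
  is the second moment of the difference of the coordinates after \<open>n\<close> steps. It tends to \<open>0\<close> when
  \<open>n * h\<close> is kept fixed.\<close>

lemma diagonal_walk_bound:
  fixes D :: "real \<Rightarrow> real \<Rightarrow> real"
  assumes mid: "\<And>a b h. \<lbrakk>a \<in> {0..1}; b \<in> {0..1}; a + h \<in> {0..1}; b + h \<in> {0..1}\<rbrakk>
      \<Longrightarrow> D a b \<le> (D a (b + h) + D (a + h) b) / 2"
    and lip: "\<And>a b a' b'. \<lbrakk>a \<in> {0..1}; b \<in> {0..1}; a' \<in> {0..1}; b' \<in> {0..1}\<rbrakk>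
      \<Longrightarrow> \<bar>D a b - D a' b'\<bar> \<le> L * (\<bar>a - a'\<bar> + \<bar>b - b'\<bar>)"
    and e: "e > 0"
  shows "\<lbrakk>a \<in> {0..1}; b \<in> {0..1}; a + real n * h \<in> {0..1}; b + real n * h \<in> {0..1}\<rbrakk>
    \<Longrightarrow> D a b \<le> D ((a + b + real n * h) / 2) ((a + b + real n * h) / 2)
          + e + L\<^sup>2 / (4 * e) * ((a - b)\<^sup>2 + real n * h\<^sup>2)"
proof (induction n arbitrary: a b)
  case 0
  let ?m = "(a + b) / 2"
  have "\<bar>D a b - D ?m ?m\<bar> \<le> L * (\<bar>a - ?m\<bar> + \<bar>b - ?m\<bar>)"
    using 0 by (intro lip) auto
  also have "\<bar>a - ?m\<bar> + \<bar>b - ?m\<bar> = \<bar>a - b\<bar>"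
    by (simp add: abs_if field_simps)
  \<comment> \<open>Completing a square trades the absolute value for a square, and second moments
    can be followed exactly along the recursion.\<close>
  also have "L * \<bar>a - b\<bar> \<le> e + L\<^sup>2 / (4 * e) * (a - b)\<^sup>2"
  proof -
    have "0 \<le> (2 * e - L * \<bar>a - b\<bar>)\<^sup>2" by simp
    also have "\<dots> = 4 * e\<^sup>2 - 4 * e * (L * \<bar>a - b\<bar>) + L\<^sup>2 * (a - b)\<^sup>2"
      by (simp add: power2_diff power_mult_distrib)
    finally show ?thesis
      using e by (simp add: field_simps power2_eq_square)
  qed
  finally show ?case by simp
next
  case (Suc n)
  \<comment> \<open>Every position reached lies between \<open>x\<close> and
    \<open>x + real (Suc n) * h\<close>, whatever the sign of \<open>h\<close>.\<close>
  have between: "x + h \<in> {0..1} \<and> x + real n * h \<in> {0..1} \<and> (x + h) + real n * h \<in> {0..1}"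
    if "x \<in> {0..1}" "x + real (Suc n) * h \<in> {0..1}" for x
  proof (cases "h \<ge> 0")
    case True
    then have "0 \<le> real n * h" by simp
    with True that show ?thesis
      unfolding atLeastAtMost_iff of_nat_Suc distrib_right mult_1 by linarith
  next
    case False
    then have "real n * h \<le> 0" by (simp add: mult_nonneg_nonpos)
    with False that show ?thesis
      unfolding atLeastAtMost_iff of_nat_Suc distrib_right mult_1 by linarith
  qed
  note a = between[OF Suc.prems(1,3)] and b = between[OF Suc.prems(2,4)]
  let ?m = "(a + b + real (Suc n) * h) / 2"
  \<comment> \<open>A step raises \<open>a + b\<close> by \<open>h\<close> whichever coordinate
    moves, so both branches aim at the same diagonal point.\<close>
  have m: "(a + (b + h) + real n * h) / 2 = ?m" "((a + h) + b + real n * h) / 2 = ?m"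
    by (simp_all add: algebra_simps)
  have 1: "D a (b + h) \<le> D ?m ?m + e + L\<^sup>2 / (4 * e) * ((a - (b + h))\<^sup>2 + real n * h\<^sup>2)"
    using Suc.IH[of a "b + h"] a b Suc.prems unfolding m by blast
  have 2: "D (a + h) b \<le> D ?m ?m + e + L\<^sup>2 / (4 * e) * (((a + h) - b)\<^sup>2 + real n * h\<^sup>2)"
    using Suc.IH[of "a + h" b] a b Suc.prems unfolding m by blast
  have avg: "(d + d') / 2 \<le> M + e + (P + Q) / 2" if "d \<le> M + e + P" "d' \<le> M + e + Q"
    for d d' M P Q :: real
    using that by (simp add: field_simps)
  have "D a b \<le> (D a (b + h) + D (a + h) b) / 2"
    using Suc.prems a b by (intro mid) auto
  also have "\<dots> \<le> D ?m ?m + e + (L\<^sup>2 / (4 * e) * ((a - (b + h))\<^sup>2 + real n * h\<^sup>2)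
      + L\<^sup>2 / (4 * e) * (((a + h) - b)\<^sup>2 + real n * h\<^sup>2)) / 2"
    using avg[OF 1 2] .
  also have "(L\<^sup>2 / (4 * e) * ((a - (b + h))\<^sup>2 + real n * h\<^sup>2)
      + L\<^sup>2 / (4 * e) * (((a + h) - b)\<^sup>2 + real n * h\<^sup>2)) / 2
    = L\<^sup>2 / (4 * e) * (((a - (b + h))\<^sup>2 + real n * h\<^sup>2 + (((a + h) - b)\<^sup>2 + real n * h\<^sup>2)) / 2)"
    by (simp only: distrib_left times_divide_eq_right)
  \<comment> \<open>The cross terms in \<open>h * (a - b)\<close> cancel between the two branches,
    which leaves one extra \<open>h\<^sup>2\<close>.\<close>
  also have "((a - (b + h))\<^sup>2 + real n * h\<^sup>2 + (((a + h) - b)\<^sup>2 + real n * h\<^sup>2)) / 2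
      = (a - b)\<^sup>2 + real (Suc n) * h\<^sup>2"
    by (simp add: power2_eq_square field_simps)
  finally show ?case .
qed

text \<open>The walk starts at \<open>(x, x)\<close> and makes \<open>n\<close> steps of size
  \<open>2 * (m - x) / n\<close>, so its mean endpoint is \<open>(m, m)\<close> and the error term
  tends to \<open>0\<close>. If all steps fall on one coordinate, that coordinate ends at
  \<open>2 * m - x\<close>, which must lie in the interval.\<close>

lemma diagonal_le_of_midpoint:
  fixes D :: "real \<Rightarrow> real \<Rightarrow> real"
  assumes mid: "\<And>a b h. \<lbrakk>a \<in> {0..1}; b \<in> {0..1}; a + h \<in> {0..1}; b + h \<in> {0..1}\<rbrakk>
      \<Longrightarrow> D a b \<le> (D a (b + h) + D (a + h) b) / 2"
    and lip: "\<And>a b a' b'. \<lbrakk>a \<in> {0..1}; b \<in> {0..1}; a' \<in> {0..1}; b' \<in> {0..1}\<rbrakk>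
      \<Longrightarrow> \<bar>D a b - D a' b'\<bar> \<le> L * (\<bar>a - a'\<bar> + \<bar>b - b'\<bar>)"
    and x: "x \<in> {0..1}" and y: "2 * m - x \<in> {0..1}"
  shows "D x x \<le> D m m"
proof (rule field_le_epsilon)
  fix e :: real assume "e > 0"
  define H where "H = 2 * (m - x)"
  \<comment> \<open>Half of \<open>e\<close> is spent on the constant error; this \<open>n\<close>
    makes the second moment term at most the other half.\<close>
  obtain n :: nat where n: "real n > L\<^sup>2 / (e\<^sup>2) * H\<^sup>2" "n > 0"
  proof -
    obtain k where "real k > L\<^sup>2 / (e\<^sup>2) * H\<^sup>2" using reals_Archimedean2 by blast
    then show ?thesis by (intro that[of "Suc k"]) auto
  qed
  define h where "h = H / real n"
  have nh: "real n * h = H" using n by (simp add: h_def)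
  have "D x x \<le> D ((x + x + real n * h) / 2) ((x + x + real n * h) / 2)
          + e / 2 + L\<^sup>2 / (4 * (e / 2)) * ((x - x)\<^sup>2 + real n * h\<^sup>2)"
    using x y \<open>e > 0\<close> by (intro diagonal_walk_bound mid lip) (auto simp: nh, auto simp: H_def)
  also have "(x + x + real n * h) / 2 = m" unfolding nh H_def by simp
  also have "L\<^sup>2 / (4 * (e / 2)) * ((x - x)\<^sup>2 + real n * h\<^sup>2) \<le> e / 2"
  proof -
    have "L\<^sup>2 / (4 * (e / 2)) * ((x - x)\<^sup>2 + real n * h\<^sup>2) = (e / 2) * (L\<^sup>2 / e\<^sup>2 * H\<^sup>2 / real n)"
      using \<open>e > 0\<close> n by (simp add: h_def power2_eq_square field_simps)
    also have "L\<^sup>2 / e\<^sup>2 * H\<^sup>2 / real n \<le> 1"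
      using n by (subst divide_le_eq_1_pos) auto
    finally show ?thesis using \<open>e > 0\<close> by simp
  qed
  finally show "D x x \<le> D m m + e" by simp
qed

text \<open>A walk from \<open>1/2\<close> with mean \<open>0\<close> could leave the interval.
  Between \<open>t\<close> and \<open>t / 2\<close> with \<open>t \<le> 1/2\<close> both
  inequalities are available, so \<open>D\<close> takes one value along the powers of
  \<open>1/2\<close> and, by continuity, at their limit \<open>0\<close>.\<close>

lemma diagonal_zero_eq_half:
  fixes D :: "real \<Rightarrow> real \<Rightarrow> real"
  assumes mid: "\<And>a b h. \<lbrakk>a \<in> {0..1}; b \<in> {0..1}; a + h \<in> {0..1}; b + h \<in> {0..1}\<rbrakk>
      \<Longrightarrow> D a b \<le> (D a (b + h) + D (a + h) b) / 2"
    and lip: "\<And>a b a' b'. \<lbrakk>a \<in> {0..1}; b \<in> {0..1}; a' \<in> {0..1}; b' \<in> {0..1}\<rbrakk>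
      \<Longrightarrow> \<bar>D a b - D a' b'\<bar> \<le> L * (\<bar>a - a'\<bar> + \<bar>b - b'\<bar>)"
  shows "D 0 0 = D (1/2) (1/2)"
proof -
  note le = diagonal_le_of_midpoint[OF mid lip]
  have half: "D ((1/2) ^ Suc n) ((1/2) ^ Suc n) = D (1/2) (1/2)" for n
  proof (induction n)
    case (Suc n)
    define t :: real where "t = (1/2) ^ Suc n"
    have t: "0 \<le> t" "t \<le> 1/2"
      using power_le_one[of "1/2::real" n] by (auto simp: t_def)
    have "D t t = D (t/2) (t/2)"
      using t by (intro antisym le) auto
    with Suc show ?case by (simp add: t_def)
  qed simp
  have "(\<lambda>n. D ((1/2) ^ Suc n) ((1/2) ^ Suc n)) \<longlonglongrightarrow> D 0 0"
  proof (rule Lim_null_comparison[THEN Lim_null[THEN iffD2]])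
    show "\<forall>\<^sub>F n in sequentially. norm (D ((1/2) ^ Suc n) ((1/2) ^ Suc n) - D 0 0)
        \<le> L * (\<bar>(1/2) ^ Suc n - 0\<bar> + \<bar>(1/2) ^ Suc n - 0\<bar>)"
      unfolding real_norm_def by (intro always_eventually allI lip) (auto intro!: power_le_one simp del: power_Suc)
    have "(\<lambda>n. (1/2::real) ^ Suc n) \<longlonglongrightarrow> 0"
      by (intro LIMSEQ_Suc LIMSEQ_realpow_zero) auto
    then have "(\<lambda>n. L * (\<bar>(1/2) ^ Suc n - 0\<bar> + \<bar>(1/2) ^ Suc n - 0\<bar>)) \<longlonglongrightarrow> L * (\<bar>0 - 0\<bar> + \<bar>0 - 0\<bar>)"
      by (intro tendsto_intros)
    then show "(\<lambda>n. L * (\<bar>(1/2) ^ Suc n - 0\<bar> + \<bar>(1/2) ^ Suc n - 0\<bar>)) \<longlonglongrightarrow> 0" by simp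
  qed
  then show ?thesis unfolding half by (metis LIMSEQ_const_iff)
qed

text \<open>Reflecting both coordinates at \<open>1/2\<close> preserves the hypotheses, with
  \<open>- h\<close> for \<open>h\<close>. Hence both ends of the diagonal share the value at the
  centre.\<close>

lemma diagonal_zero_eq_one:
  fixes D :: "real \<Rightarrow> real \<Rightarrow> real"
  assumes mid: "\<And>a b h. \<lbrakk>a \<in> {0..1}; b \<in> {0..1}; a + h \<in> {0..1}; b + h \<in> {0..1}\<rbrakk>
      \<Longrightarrow> D a b \<le> (D a (b + h) + D (a + h) b) / 2"
    and lip: "\<And>a b a' b'. \<lbrakk>a \<in> {0..1}; b \<in> {0..1}; a' \<in> {0..1}; b' \<in> {0..1}\<rbrakk>
      \<Longrightarrow> \<bar>D a b - D a' b'\<bar> \<le> L * (\<bar>a - a'\<bar> + \<bar>b - b'\<bar>)"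
  shows "D 0 0 = D 1 1"
proof -
  have "D (1 - 0) (1 - 0) = D (1 - 1/2) (1 - 1/2)"
  proof (rule diagonal_zero_eq_half[where D = "\<lambda>a b. D (1 - a) (1 - b)" and L = L])
    fix a b h :: real
    assume "a \<in> {0..1}" "b \<in> {0..1}" "a + h \<in> {0..1}" "b + h \<in> {0..1}"
    then show "D (1 - a) (1 - b) \<le> (D (1 - a) (1 - (b + h)) + D (1 - (a + h)) (1 - b)) / 2"
      using mid[of "1 - a" "1 - b" "- h"] by (simp add: algebra_simps)
  next
    fix a b a' b' :: real
    assume "a \<in> {0..1}" "b \<in> {0..1}" "a' \<in> {0..1}" "b' \<in> {0..1}"
    then show "\<bar>D (1 - a) (1 - b) - D (1 - a') (1 - b')\<bar> \<le> L * (\<bar>a - a'\<bar> + \<bar>b - b'\<bar>)"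
      using lip[of "1 - a" "1 - b" "1 - a'" "1 - b'"] by (simp add: abs_minus_commute)
  qed
  with diagonal_zero_eq_half[OF mid lip] show ?thesis by simp
qed

section \<open>Embeddings that turn geodesics into linear segments\<close>

text \<open>The interface between affine functions and the norm: \<open>segment\<close> leads to
  convexity and translation invariance, \<open>strict\<close> to strict convexity.\<close>

locale segment_embedding =
  fixes g :: "'a::metric_space \<Rightarrow> 'v::real_vector"
  assumes inj: "inj g"
    and segment: "\<And>x y. \<exists>c. \<forall>s\<in>{0..1}. g (c s) = (1 - s) *\<^sub>R g x + s *\<^sub>R g y \<and>
        (\<forall>t\<in>{0..1}. dist (c s) (c t) = \<bar>s - t\<bar> * dist x y)"
    and strict: "\<And>x y z. dist x y + dist y z = dist x z \<Longrightarrow>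
        \<exists>t\<in>{0..1}. g y = (1 - t) *\<^sub>R g x + t *\<^sub>R g z"
begin

lemma g_eq_iff [simp]: "g x = g y \<longleftrightarrow> x = y"
  using inj by (simp add: inj_eq)

lemma segment_point_exists:
  assumes "t \<in> {0..1}"
  shows "\<exists>z. g z = (1 - t) *\<^sub>R g x + t *\<^sub>R g y"
  using segment[of x y] assms by blast

text \<open>Injectivity of \<open>g\<close> identifies \<open>z\<close> with the point
  \<open>c t\<close> of the path from \<open>segment\<close>, whose distances are known.\<close>

lemma dist_segment_point:
  assumes t: "t \<in> {0..1}" and z: "g z = (1 - t) *\<^sub>R g x + t *\<^sub>R g y"
  shows "dist x z = t * dist x y" "dist z y = (1 - t) * dist x y"
proof -
  obtain c where c: "\<And>s. s \<in> {0..1} \<Longrightarrow> g (c s) = (1 - s) *\<^sub>R g x + s *\<^sub>R g y"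
    and d: "\<And>s t. \<lbrakk>s \<in> {0..1}; t \<in> {0..1}\<rbrakk> \<Longrightarrow> dist (c s) (c t) = \<bar>s - t\<bar> * dist x y"
    using segment[of x y] by blast
  have "g (c 0) = g x" "g (c 1) = g y" "g (c t) = g z"
    using c[of 0] c[of 1] c[OF t] z by simp_all
  then have eq: "c 0 = x" "c 1 = y" "c t = z" by simp_all
  show "dist x z = t * dist x y" "dist z y = (1 - t) * dist x y"
    using d[of 0 t] d[of t 1] t by (auto simp: eq)
qed

text \<open>The pairs \<open>p a\<close>, \<open>q (b + h)\<close> and \<open>p (a + h)\<close>, \<open>q b\<close> on opposite sides of the
  parallelogram have the same midpoint, and the triangle inequality through it gives the hypothesis
  on \<open>D\<close> in the preceding lemmas.\<close>

lemma dist_translation: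
  assumes par: "g x' - g x = g y' - g y"
  shows "dist x x' = dist y y'"
proof -
  obtain p where p: "\<And>s. s \<in> {0..1} \<Longrightarrow> g (p s) = (1 - s) *\<^sub>R g x + s *\<^sub>R g y"
    and dp: "\<And>s t. \<lbrakk>s \<in> {0..1}; t \<in> {0..1}\<rbrakk> \<Longrightarrow> dist (p s) (p t) = \<bar>s - t\<bar> * dist x y"
    using segment[of x y] by blast
  obtain q where q: "\<And>s. s \<in> {0..1} \<Longrightarrow> g (q s) = (1 - s) *\<^sub>R g x' + s *\<^sub>R g y'"
    and dq: "\<And>s t. \<lbrakk>s \<in> {0..1}; t \<in> {0..1}\<rbrakk> \<Longrightarrow> dist (q s) (q t) = \<bar>s - t\<bar> * dist x' y'"
    using segment[of x' y'] by blast
  have par': "g y' = g x' + g y - g x" using par by (simp add: algebra_simps)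
  \<comment> \<open>The paths \<open>p\<close> and \<open>q\<close> run along opposite sides; the
    values of \<open>D\<close> at the ends of the diagonal are the lengths of the other two sides.
    The sum of the speeds is a Lipschitz constant.\<close>
  have "dist (p 0) (q 0) = dist (p 1) (q 1)"
  proof (rule diagonal_zero_eq_one[where D = "\<lambda>a b. dist (p a) (q b)" and L = "dist x y + dist x' y'"])
    fix a b h :: real
    assume *: "a \<in> {0..1}" "b \<in> {0..1}" "a + h \<in> {0..1}" "b + h \<in> {0..1}"
    obtain m where m: "g m = (1 - 1/2) *\<^sub>R g (p a) + (1/2) *\<^sub>R g (q (b + h))"
      using segment_point_exists[of "1/2"] by auto
    have "2 *\<^sub>R g m = g (p a) + g (q (b + h))"
      unfolding m by (simp add: scaleR_add_right)
    \<comment> \<open>By \<open>par\<close> both paths have the same velocity in the vector space,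
      so moving the time \<open>h\<close> from \<open>q\<close> to \<open>p\<close> keeps the
      sum.\<close>
    also have "\<dots> = g (p (a + h)) + g (q b)"
      unfolding p[OF *(1)] p[OF *(3)] q[OF *(2)] q[OF *(4)] par' by (simp add: algebra_simps)
    finally have "(1/2) *\<^sub>R (2 *\<^sub>R g m) = (1/2) *\<^sub>R (g (p (a + h)) + g (q b))" by (rule arg_cong)
    then have m': "g m = (1 - 1/2) *\<^sub>R g (p (a + h)) + (1/2) *\<^sub>R g (q b)"
      by (simp add: scaleR_add_right)
    have "dist (p a) (q b) \<le> dist (p a) m + dist m (q b)" by (rule dist_triangle)
    also have "dist (p a) m = dist (p a) (q (b + h)) / 2"
      using dist_segment_point(1)[OF _ m] by simp
    also have "dist m (q b) = dist (p (a + h)) (q b) / 2"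
      using dist_segment_point(2)[OF _ m'] by simp
    finally show "dist (p a) (q b) \<le> (dist (p a) (q (b + h)) + dist (p (a + h)) (q b)) / 2" by simp
  next
    fix a b a' b' :: real
    assume *: "a \<in> {0..1}" "b \<in> {0..1}" "a' \<in> {0..1}" "b' \<in> {0..1}"
    have "\<bar>dist (p a) (q b) - dist (p a') (q b')\<bar> \<le> dist (p a) (p a') + dist (q b) (q b')"
      by (smt (verit) dist_commute dist_triangle)
    also have "\<dots> = \<bar>a - a'\<bar> * dist x y + \<bar>b - b'\<bar> * dist x' y'"
      using * by (simp add: dp dq)
    also have "\<dots> \<le> (dist x y + dist x' y') * (\<bar>a - a'\<bar> + \<bar>b - b'\<bar>)"
      by (simp add: algebra_simps)
    finally show "\<bar>dist (p a) (q b) - dist (p a') (q b')\<bar> \<le> (dist x y + dist x' y') * (\<bar>a - a'\<bar> + \<bar>b - b'\<bar>)" .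
  qed
  moreover have "g (p 0) = g x" "g (p 1) = g y" "g (q 0) = g x'" "g (q 1) = g y'"
    using p[of 0] p[of 1] q[of 0] q[of 1] by simp_all
  ultimately show ?thesis by simp
qed

section \<open>The norm on the span of the differences\<close>

text \<open>Since the range of \<open>g\<close> is convex, this cone is already the linear span of
  all differences.\<close>

definition directions :: "'v set" where
  "directions = {t *\<^sub>R (g y - g x) | t x y. t > 0}"

text \<open>The value is independent of the chosen representation by
  \<open>scaled_dist_unique\<close>.\<close>

definition direction_norm :: "'v \<Rightarrow> real" where
  "direction_norm v = (SOME r. \<exists>t x y. t > 0 \<and> v = t *\<^sub>R (g y - g x) \<and> r = t * dist x y)"

lemma directionsI: "t > 0 \<Longrightarrow> t *\<^sub>R (g y - g x) \<in> directions"
  unfolding directions_def by blast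

lemma diff_in_directions: "g y - g x \<in> directions"
  using directionsI[of 1] by simp

lemma shrink_diff:
  assumes "s \<in> {0..1}"
  shows "\<exists>z. g z - g x = s *\<^sub>R (g y - g x)"
proof -
  obtain z where "g z = (1 - s) *\<^sub>R g x + s *\<^sub>R g y"
    using segment_point_exists[OF assms] by blast
  then show ?thesis by (intro exI[of _ z]) (simp add: algebra_simps)
qed

text \<open>For \<open>t \<le> t'\<close>, shrinking the segment from \<open>x\<close> to
  \<open>y\<close> by \<open>t / t'\<close> gives a translate of the one from \<open>x'\<close> to
  \<open>y'\<close>, and translates have equal length.\<close>

lemma scaled_dist_unique:
  assumes "t > 0" "t' > 0" and eq: "t *\<^sub>R (g y - g x) = t' *\<^sub>R (g y' - g x')"
  shows "t * dist x y = t' * dist x' y'"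
proof -
  have *: "t * dist x y = t' * dist x' y'"
    if "t > 0" "t' > 0" "t \<le> t'" and eq: "t *\<^sub>R (g y - g x) = t' *\<^sub>R (g y' - g x')"
    for t t' x y x' y'
  proof -
    have s: "t / t' \<in> {0..1}" using that by auto
    obtain z where z: "g z = (1 - t / t') *\<^sub>R g x + (t / t') *\<^sub>R g y"
      using segment_point_exists[OF s] by blast
    have "(1 / t') *\<^sub>R (t *\<^sub>R (g y - g x)) = (1 / t') *\<^sub>R (t' *\<^sub>R (g y' - g x'))"
      using eq by (rule arg_cong)
    then have "g z - g x = g y' - g x'"
      using \<open>t' > 0\<close> by (simp add: z algebra_simps)
    then have "dist x z = dist x' y'" by (rule dist_translation)
    with dist_segment_point(1)[OF s z] show ?thesis using \<open>t' > 0\<close> by (simp add: field_simps)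
  qed
  show ?thesis
    using *[OF assms(1,2) _ eq] *[OF assms(2,1) _ eq[symmetric]] by (cases "t \<le> t'") auto
qed

lemma direction_norm_eq:
  assumes "t > 0"
  shows "direction_norm (t *\<^sub>R (g y - g x)) = t * dist x y"
  unfolding direction_norm_def
proof (rule some_equality)
  show "\<exists>t' x' y'. t' > 0 \<and> t *\<^sub>R (g y - g x) = t' *\<^sub>R (g y' - g x') \<and> t * dist x y = t' * dist x' y'"
    using assms by blast
qed (use assms scaled_dist_unique in metis)

lemma direction_norm_diff: "direction_norm (g y - g x) = dist x y"
  using direction_norm_eq[of 1] by simp

text \<open>Placing two directions head to tail at a common scale reduces statements about
  \<open>v + w\<close> to the triangle inequality in the metric space.\<close>

lemma directions_common_triangle:
  assumes "v \<in> directions" "w \<in> directions"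
  obtains T a b c where "T > 0" "v = T *\<^sub>R (g b - g a)" "w = T *\<^sub>R (g c - g b)"
proof -
  obtain t x y where v: "t > 0" "v = t *\<^sub>R (g y - g x)"
    using assms(1) unfolding directions_def by blast
  obtain s x' y' where w: "s > 0" "w = s *\<^sub>R (g y' - g x')"
    using assms(2) unfolding directions_def by blast
  \<comment> \<open>The larger factor is the common scale, so that both segments are shrunk and stay
    in the range.\<close>
  define m where "m = max s t"
  have m: "m > 0" "t / m \<in> {0..1}" "s / m \<in> {0..1}" using v w by (auto simp: m_def)
  obtain z where z: "g z - g x = (t / m) *\<^sub>R (g y - g x)" using shrink_diff[OF m(2)] by blast
  obtain z' where z': "g z' - g x' = (s / m) *\<^sub>R (g y' - g x')" using shrink_diff[OF m(3)] by blast
  have mid: "\<exists>b. g b = (1/2) *\<^sub>R (g p + g q)" for p q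
    using segment_point_exists[of "1/2" p q] by (auto simp: scaleR_add_right)
  \<comment> \<open>Moving one endpoint at a time while averaging the two segments puts their halves
    head to tail; the factor \<open>2 * m\<close> undoes the halving.\<close>
  obtain a b c where "g a = (1/2) *\<^sub>R (g x + g x')" "g b = (1/2) *\<^sub>R (g z + g x')"
      "g c = (1/2) *\<^sub>R (g z + g z')"
    using mid by blast
  then have ab: "g b - g a = (1/2) *\<^sub>R (g z - g x)" and bc: "g c - g b = (1/2) *\<^sub>R (g z' - g x')"
    by (simp_all add: algebra_simps)
  show ?thesis
  proof
    show "2 * m > 0" using m by simp
    show "v = (2 * m) *\<^sub>R (g b - g a)" "w = (2 * m) *\<^sub>R (g c - g b)"
      using m v w by (simp_all add: ab bc z z')
  qed
qed

lemma normed_space_on_directions: "normed_space_on directions direction_norm"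
proof -
  have zero: "0 \<in> directions" "direction_norm 0 = 0"
    \<comment> \<open>Any point serves here: zero is its difference from itself.\<close>
    using diff_in_directions[of undefined undefined] direction_norm_diff[of undefined undefined] by simp_all
  have scale: "c *\<^sub>R v \<in> directions \<and> direction_norm (c *\<^sub>R v) = \<bar>c\<bar> * direction_norm v"
    if v: "v \<in> directions" for c v
  proof -
    obtain t x y where txy: "t > 0" "v = t *\<^sub>R (g y - g x)"
      using v unfolding directions_def by blast
    consider "c = 0" | "c > 0" | "c < 0" by linarith
    then show ?thesis
    proof cases
      case 2
      then show ?thesis
        using txy directionsI[of "c * t" y x] direction_norm_eq[of "c * t" y x] direction_norm_eq[of t y x] by simp
    next
      case 3
      \<comment> \<open>A negative factor is absorbed by exchanging the endpoints.\<close>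
      have "c *\<^sub>R v = (- c * t) *\<^sub>R (g x - g y)" unfolding txy(2) by (simp add: algebra_simps)
      then show ?thesis
        using 3 txy directionsI[of "- c * t" x y] direction_norm_eq[of "- c * t" x y]
          direction_norm_eq[of t y x]
        by (simp add: dist_commute mult_neg_pos del: mult_minus_left)
    qed (simp add: zero)
  qed
  have add: "v + w \<in> directions \<and> direction_norm (v + w) \<le> direction_norm v + direction_norm w"
    if vw: "v \<in> directions" "w \<in> directions" for v w
  proof -
    obtain T a b c where T: "T > 0" "v = T *\<^sub>R (g b - g a)" "w = T *\<^sub>R (g c - g b)"
      using directions_common_triangle[OF vw] .
    have sum: "v + w = T *\<^sub>R (g c - g a)" by (simp add: T algebra_simps)
    have "T * dist a c \<le> T * (dist a b + dist b c)"
      using T(1) by (intro mult_left_mono dist_triangle) auto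
    then show ?thesis
      unfolding sum using T directionsI direction_norm_eq by (simp add: distrib_left)
  qed
  have "direction_norm v \<ge> 0 \<and> (direction_norm v = 0 \<longleftrightarrow> v = 0)" if v: "v \<in> directions" for v
  proof -
    obtain t x y where "t > 0" "v = t *\<^sub>R (g y - g x)"
      using v unfolding directions_def by blast
    then show ?thesis using direction_norm_eq[of t y x] by auto
  qed
  then show ?thesis
    unfolding normed_space_on_def subspace_def using zero scale add by blast
qed

text \<open>Equality would put the middle vertex of the common triangle on the opposite side, making
  \<open>v\<close> and \<open>w\<close> linearly dependent.\<close>

lemma strictly_convex_directions: "strictly_convex_norm_on directions direction_norm"
  unfolding strictly_convex_norm_on_def
proof (intro ballI impI)
  fix v w
  assume vw: "v \<in> directions" "w \<in> directions"
    and indep: "\<forall>a b::real. a *\<^sub>R v + b *\<^sub>R w = 0 \<longrightarrow> a = 0 \<and> b = 0"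
  obtain T a b c where T: "T > 0" "v = T *\<^sub>R (g b - g a)" "w = T *\<^sub>R (g c - g b)"
    using directions_common_triangle[OF vw] .
  have sum: "v + w = T *\<^sub>R (g c - g a)" by (simp add: T algebra_simps)
  have "dist a b + dist b c \<noteq> dist a c"
  proof
    assume "dist a b + dist b c = dist a c"
    then obtain t where t: "g b = (1 - t) *\<^sub>R g a + t *\<^sub>R g c" using strict by blast
    have "(1 - t) *\<^sub>R v + (- t) *\<^sub>R w = T *\<^sub>R (g b - ((1 - t) *\<^sub>R g a + t *\<^sub>R g c))"
      unfolding T by (simp add: algebra_simps)
    also have "\<dots> = 0" by (simp add: t)
    finally have "(1 - t) *\<^sub>R v + (- t) *\<^sub>R w = 0" .
    with indep have "1 - t = 0 \<and> - t = 0" by blast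
    then show False by linarith
  qed
  then have "dist a c < dist a b + dist b c" using dist_triangle[of a c b] by linarith
  then have "T * dist a c < T * dist a b + T * dist b c"
    using T(1) by (simp flip: distrib_left)
  then show "direction_norm (v + w) < direction_norm v + direction_norm w"
    unfolding sum unfolding T using T(1) by (simp add: direction_norm_eq)
qed

text \<open>With the origin in the range, each image point is itself a difference of image
  points.\<close>

lemma isometric_to_convex_subset_directions:
  assumes "0 \<in> range g"
  shows "isometric_to_convex_subset TYPE('a) directions direction_norm"
  unfolding isometric_to_convex_subset_def
proof (intro exI conjI allI)
  obtain o' where o': "g o' = 0" using assms by (metis rangeE)
  show "range g \<subseteq> directions" using diff_in_directions[of _ o'] by (auto simp: o')
  show "convex (range g)"
    unfolding convex_alt using segment_point_exists by (auto simp: image_iff) (metis)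
  show "direction_norm (g x - g y) = dist x y" for x y
    by (simp add: direction_norm_diff dist_commute)
qed

end

section \<open>Geodesics and affine functions\<close>

lemma geodesic_onD:
  "geodesic_on I \<gamma> \<Longrightarrow> s \<in> I \<Longrightarrow> t \<in> I \<Longrightarrow> dist (\<gamma> s) (\<gamma> t) = \<bar>s - t\<bar>"
  unfolding geodesic_on_def by blast

lemma geodesic_between:
  assumes "geodesic_space TYPE('a::metric_space)"
  obtains \<gamma> where "geodesic_on {0..dist x y} \<gamma>" "\<gamma> 0 = (x::'a)" "\<gamma> (dist x y) = y"
  using assms unfolding geodesic_space_def by blast

lemma affine_fun_along_geodesic:
  fixes f :: "'a::metric_space \<Rightarrow> real"
  assumes f: "affine_fun f" and \<gamma>: "geodesic_on {0..dist x y} \<gamma>" "\<gamma> 0 = x" "\<gamma> (dist x y) = y"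
    and s: "s \<in> {0..1}"
  shows "f (\<gamma> (s * dist x y)) = (1 - s) * f x + s * f y"
proof -
  obtain a b where ab: "\<And>t. t \<in> {0..dist x y} \<Longrightarrow> f (\<gamma> t) = a * t + b"
    using f \<gamma>(1) unfolding affine_fun_def by blast
  have "s * dist x y \<in> {0..dist x y}"
    using s by (auto simp: mult_left_le_one_le)
  from ab[OF this] ab[of 0] ab[of "dist x y"] show ?thesis
    using \<gamma>(2,3) by (simp add: algebra_simps)
qed

lemma geodesic_on_concat:
  assumes \<alpha>: "geodesic_on {0..dist x y} \<alpha>" "\<alpha> 0 = x" "\<alpha> (dist x y) = y"
    and \<beta>: "geodesic_on {0..dist y z} \<beta>" "\<beta> 0 = y" "\<beta> (dist y z) = z"
    and eq: "dist x y + dist y z = dist x z"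
  shows "geodesic_on {0..dist x z} (\<lambda>t. if t \<le> dist x y then \<alpha> t else \<beta> (t - dist x y))"
    (is "geodesic_on _ ?\<gamma>")
proof -
  have cross: "dist (\<alpha> s) (\<beta> (t - dist x y)) = t - s"
    if "0 \<le> s" "s \<le> dist x y" "dist x y \<le> t" "t \<le> dist x z" for s t
  proof (rule antisym)
    have 1: "dist (\<alpha> s) y = dist x y - s" "dist x (\<alpha> s) = s"
      using geodesic_onD[OF \<alpha>(1), of s "dist x y"] geodesic_onD[OF \<alpha>(1), of 0 s] \<alpha>(2,3) that by auto
    have 2: "dist y (\<beta> (t - dist x y)) = t - dist x y" "dist (\<beta> (t - dist x y)) z = dist x z - t"
      using geodesic_onD[OF \<beta>(1), of 0 "t - dist x y"] geodesic_onD[OF \<beta>(1), of "t - dist x y" "dist y z"]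
        \<beta>(2,3) that eq by auto
    show "dist (\<alpha> s) (\<beta> (t - dist x y)) \<le> t - s"
      using dist_triangle[of "\<alpha> s" "\<beta> (t - dist x y)" y] 1 2 by simp
    \<comment> \<open>A shortcut between the two points would make the way from \<open>x\<close> to
      \<open>z\<close> shorter than \<open>dist x z\<close>.\<close>
    show "t - s \<le> dist (\<alpha> s) (\<beta> (t - dist x y))"
      using dist_triangle[of x z "\<alpha> s"] dist_triangle[of "\<alpha> s" z "\<beta> (t - dist x y)"] 1 2 by linarith
  qed
  have ordered: "dist (?\<gamma> s) (?\<gamma> t) = t - s" if "0 \<le> s" "s \<le> t" "t \<le> dist x z" for s t
    using that cross[of s t] geodesic_onD[OF \<alpha>(1), of s t] eq
      geodesic_onD[OF \<beta>(1), of "s - dist x y" "t - dist x y"] by auto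
  have "dist (?\<gamma> s) (?\<gamma> t) = \<bar>s - t\<bar>" if st: "s \<in> {0..dist x z}" "t \<in> {0..dist x z}" for s t
  proof (cases "s \<le> t")
    case True
    have "dist (?\<gamma> s) (?\<gamma> t) = t - s" using st True by (intro ordered) auto
    also have "\<dots> = \<bar>s - t\<bar>" using True by simp
    finally show ?thesis .
  next
    case False
    have "dist (?\<gamma> s) (?\<gamma> t) = dist (?\<gamma> t) (?\<gamma> s)" by (rule dist_commute)
    also have "\<dots> = s - t" using st False by (intro ordered) auto
    also have "\<dots> = \<bar>s - t\<bar>" using False by simp
    finally show ?thesis .
  qed
  then show ?thesis unfolding geodesic_on_def by (auto simp: is_interval_cc)
qed

text \<open>Geodesics from \<open>x\<close> to \<open>y\<close> and from \<open>y\<close> to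
  \<open>z\<close> join to one geodesic, so a single parameter, \<open>dist x y / dist x z\<close>,
  works for every affine function.\<close>

lemma affine_fun_between:
  fixes x y z :: "'a::metric_space"
  assumes geo: "geodesic_space TYPE('a)" and eq: "dist x y + dist y z = dist x z"
  shows "\<exists>t\<in>{0..1}. \<forall>f. affine_fun f \<longrightarrow> f y = (1 - t) * f x + t * f z"
proof (cases "x = z")
  case True
  with eq have "y = x" by (simp add: dist_commute)
  then show ?thesis by (intro bexI[of _ 0]) auto
next
  case False
  obtain \<alpha> where \<alpha>: "geodesic_on {0..dist x y} \<alpha>" "\<alpha> 0 = x" "\<alpha> (dist x y) = y"
    using geodesic_between[OF geo] .
  obtain \<beta> where \<beta>: "geodesic_on {0..dist y z} \<beta>" "\<beta> 0 = y" "\<beta> (dist y z) = z"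
    using geodesic_between[OF geo] .
  define \<gamma> where "\<gamma> = (\<lambda>t. if t \<le> dist x y then \<alpha> t else \<beta> (t - dist x y))"
  have \<gamma>: "geodesic_on {0..dist x z} \<gamma>"
    unfolding \<gamma>_def by (rule geodesic_on_concat[OF \<alpha> \<beta> eq])
  have ends: "\<gamma> 0 = x" "\<gamma> (dist x y) = y" by (simp_all add: \<gamma>_def \<alpha>)
  \<comment> \<open>If \<open>y = z\<close>, the final parameter still belongs to the branch of
    \<open>\<alpha>\<close>.\<close>
  have "\<gamma> (dist x z) = z"
  proof (cases "y = z")
    case True
    show ?thesis using \<alpha>(3) unfolding \<gamma>_def True by simp
  next
    case False
    then have "\<not> dist x z \<le> dist x y" using eq zero_less_dist_iff[of y z] by linarith
    then show ?thesis using \<beta>(3) eq[symmetric] by (simp add: \<gamma>_def)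
  qed
  note along = affine_fun_along_geodesic[OF _ \<gamma> ends(1) this]
  have t: "dist x y / dist x z \<in> {0..1}"
  proof -
    have "dist x y \<le> dist x z" using eq zero_le_dist[of y z] by linarith
    then show ?thesis using False by simp
  qed
  show ?thesis
  proof (intro bexI[OF _ t] allI impI)
    fix f :: "'a \<Rightarrow> real" assume "affine_fun f"
    from along[OF this t] show "f y = (1 - dist x y / dist x z) * f x + dist x y / dist x z * f z"
      using False ends(2) by simp
  qed
qed

section \<open>The quotient of the free vector space\<close>

text \<open>Finitely supported functions form the free vector space on \<open>'a\<close>; this is
  the linear map with values \<open>f x\<close> on the basis vectors
  \<open>Poly_Mapping.single x 1\<close>.\<close>

definition free_extend :: "('a \<Rightarrow> real) \<Rightarrow> ('a \<Rightarrow>\<^sub>0 real) \<Rightarrow> real" where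
  "free_extend f v = (\<Sum>x\<in>Poly_Mapping.keys v. Poly_Mapping.lookup v x * f x)"

lemma free_extend_superset:
  assumes "finite A" "Poly_Mapping.keys v \<subseteq> A"
  shows "free_extend f v = (\<Sum>x\<in>A. Poly_Mapping.lookup v x * f x)"
  unfolding free_extend_def using assms by (intro sum.mono_neutral_left) (auto simp: in_keys_iff)

lemma lookup_scaleR: "Poly_Mapping.lookup (c *\<^sub>R v) x = c *\<^sub>R Poly_Mapping.lookup v x"
  by (simp add: scaleR_poly_mapping_def)

lemma linear_free_extend: "linear (free_extend f)"
proof (rule linearI)
  fix v w :: "'a \<Rightarrow>\<^sub>0 real" and c :: real
  let ?A = "Poly_Mapping.keys v \<union> Poly_Mapping.keys w"
  have "Poly_Mapping.keys (v + w) \<subseteq> ?A" by (rule Poly_Mapping.keys_add)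
  then show "free_extend f (v + w) = free_extend f v + free_extend f w"
    by (simp add: free_extend_superset[of ?A] lookup_add distrib_right sum.distrib)
  have "Poly_Mapping.keys (c *\<^sub>R v) \<subseteq> Poly_Mapping.keys v"
    by (auto simp: in_keys_iff lookup_scaleR)
  then show "free_extend f (c *\<^sub>R v) = c *\<^sub>R free_extend f v"
    by (simp add: free_extend_superset[of "Poly_Mapping.keys v"] lookup_scaleR sum_distrib_left mult.assoc)
qed

lemma free_extend_single: "free_extend f (Poly_Mapping.single x 1) = f x"
  by (simp add: free_extend_def)

text \<open>The quotient by \<open>K\<close> is realized inside the same space, as the image of a
  projection that kills a basis of \<open>K\<close> and fixes the vectors completing it to a basis
  of the whole space.\<close>

lemma linear_with_kernel:
  fixes K :: "'v::real_vector set"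
  assumes K: "subspace K"
  shows "\<exists>\<pi> :: 'v \<Rightarrow> 'v. linear \<pi> \<and> (\<forall>v. \<pi> v = 0 \<longleftrightarrow> v \<in> K)"
proof -
  obtain B where B: "B \<subseteq> K" "independent B" "K \<subseteq> span B"
    using maximal_independent_subset[of K] by metis
  obtain B' where B': "B \<subseteq> B'" "independent B'" "UNIV \<subseteq> span B'"
    using maximal_independent_subset_extend[OF subset_UNIV B(2)] by metis
  obtain \<pi> :: "'v \<Rightarrow> 'v" where \<pi>: "linear \<pi>" "\<forall>b\<in>B'. \<pi> b = (if b \<in> B then 0 else b)"
    using linear_independent_extend[OF B'(2), of "\<lambda>b. if b \<in> B then 0 else b"] by metis
  have zero: "\<pi> v = 0" if "v \<in> K" for v
  proof (rule linear_eq_0_on_span[OF \<pi>(1)])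
    show "\<pi> b = 0" if "b \<in> B" for b using \<pi>(2) B'(1) that by auto
    show "v \<in> span B" using B(3) that by blast
  qed
  have diff: "v - \<pi> v \<in> K" for v
  proof -
    have "linear (\<lambda>v. v - \<pi> v)"
      using linear_compose_sub[OF linear_ident \<pi>(1)] .
    from linear_subspace_vimage[OF this K] have "subspace {v. v - \<pi> v \<in> K}"
      by (simp add: vimage_def)
    moreover have "B' \<subseteq> {v. v - \<pi> v \<in> K}"
      using \<pi>(2) B(1) K by (auto simp: subspace_0)
    ultimately have "span B' \<subseteq> {v. v - \<pi> v \<in> K}" by (simp add: span_minimal)
    with B'(3) show ?thesis by blast
  qed
  have "\<pi> v = 0 \<longleftrightarrow> v \<in> K" for v
    using zero[of v] diff[of v] by auto
  then show ?thesis using \<pi>(1) by (intro exI[of _ \<pi>] conjI allI)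
qed

lemma segment_embedding_exists:
  assumes geo: "geodesic_space TYPE('a::metric_space)"
    and sep: "affine_separates_points TYPE('a::metric_space)"
  obtains g :: "'a::metric_space \<Rightarrow> ('a, real) poly_mapping" where "segment_embedding g" "0 \<in> range g"
proof -
  define K where "K = {v. \<forall>f::'a \<Rightarrow> real. affine_fun f \<longrightarrow> free_extend f v = 0}"
  have "subspace K"
    unfolding subspace_def K_def
    by (auto simp: linear_0[OF linear_free_extend] linear_add[OF linear_free_extend]
        linear_scale[OF linear_free_extend])
  from linear_with_kernel[OF this] obtain \<pi> :: "('a \<Rightarrow>\<^sub>0 real) \<Rightarrow> ('a \<Rightarrow>\<^sub>0 real)"
    where \<pi>: "linear \<pi>" "\<forall>v. \<pi> v = 0 \<longleftrightarrow> v \<in> K"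
    by blast
  let ?\<delta> = "\<lambda>x::'a. Poly_Mapping.single x (1::real)"
  \<comment> \<open>Subtracting a base point puts \<open>0\<close> into the range.\<close>
  define g where "g x = \<pi> (?\<delta> x - ?\<delta> undefined)" for x
  note fe = linear_diff[OF linear_free_extend] linear_add[OF linear_free_extend]
    linear_scale[OF linear_free_extend] free_extend_single
  \<comment> \<open>The coefficients sum to one, so the base point cancels. Affine relations between
    image points are thus exactly those respected by all affine functions; \<open>t = 0\<close>
    gives injectivity.\<close>
  have comb: "g z = (1 - t) *\<^sub>R g x + t *\<^sub>R g y
      \<longleftrightarrow> (\<forall>f. affine_fun f \<longrightarrow> f z = (1 - t) * f x + t * f y)" for x y z t
  proof -
    have "g z - ((1 - t) *\<^sub>R g x + t *\<^sub>R g y) = \<pi> (?\<delta> z - ((1 - t) *\<^sub>R ?\<delta> x + t *\<^sub>R ?\<delta> y))"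
      unfolding g_def linear_diff[OF \<pi>(1)] linear_add[OF \<pi>(1)] linear_scale[OF \<pi>(1)]
      by (simp add: algebra_simps)
    then have "g z = (1 - t) *\<^sub>R g x + t *\<^sub>R g y \<longleftrightarrow> ?\<delta> z - ((1 - t) *\<^sub>R ?\<delta> x + t *\<^sub>R ?\<delta> y) \<in> K"
      using \<pi>(2) right_minus_eq by metis
    then show ?thesis unfolding K_def by (simp add: fe)
  qed
  have "segment_embedding g"
  proof
    show "inj g"
    proof (rule injI)
      fix x y assume "g x = g y"
      then have "\<forall>f. affine_fun f \<longrightarrow> f x = f y" using comb[of x 0 y y] by simp
      then show "x = y" using sep unfolding affine_separates_points_def by blast
    qed
  next
    fix x y :: 'a
    obtain \<gamma> where \<gamma>: "geodesic_on {0..dist x y} \<gamma>" "\<gamma> 0 = x" "\<gamma> (dist x y) = y"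
      using geodesic_between[OF geo] .
    have "dist (\<gamma> (s * dist x y)) (\<gamma> (t * dist x y)) = \<bar>s - t\<bar> * dist x y"
      if "s \<in> {0..1}" "t \<in> {0..1}" for s t
    proof -
      have "s * dist x y \<in> {0..dist x y}" "t * dist x y \<in> {0..dist x y}"
        using that by (auto simp: mult_left_le_one_le)
      then have "dist (\<gamma> (s * dist x y)) (\<gamma> (t * dist x y)) = \<bar>s * dist x y - t * dist x y\<bar>"
        by (rule geodesic_onD[OF \<gamma>(1)])
      also have "s * dist x y - t * dist x y = (s - t) * dist x y" by (simp add: left_diff_distrib)
      finally show ?thesis by (simp add: abs_mult)
    qed
    then show "\<exists>c. \<forall>s\<in>{0..1}. g (c s) = (1 - s) *\<^sub>R g x + s *\<^sub>R g y \<and>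
        (\<forall>t\<in>{0..1}. dist (c s) (c t) = \<bar>s - t\<bar> * dist x y)"
      using affine_fun_along_geodesic[OF _ \<gamma>]
      by (intro exI[of _ "\<lambda>s. \<gamma> (s * dist x y)"]) (simp add: comb)
  next
    fix x y z :: 'a
    assume "dist x y + dist y z = dist x z"
    then show "\<exists>t\<in>{0..1}. g y = (1 - t) *\<^sub>R g x + t *\<^sub>R g z"
      unfolding comb by (rule affine_fun_between[OF geo])
  qed
  moreover have "g undefined = 0" by (simp add: g_def linear_0[OF \<pi>(1)])
  then have "0 \<in> range g" by (metis rangeI)
  ultimately show ?thesis by (rule that)
qed

section \<open>Linearity of geodesics under a strictly convex norm\<close>

text \<open>Two points of \<open>I\<close> fix the line, and any further one is compared with them
  in its order. The hypothesis is linear interpolation with denominators cleared.\<close>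

lemma affine_on_of_three_points:
  fixes h :: "real \<Rightarrow> real"
  assumes three: "\<And>r s t. \<lbrakk>r \<in> I; s \<in> I; t \<in> I; r < s; s < t\<rbrakk>
    \<Longrightarrow> (t - r) * h s = (t - s) * h r + (s - r) * h t"
  shows "\<exists>a b. \<forall>t\<in>I. h t = a * t + b"
proof (cases "\<exists>p\<in>I. \<exists>q\<in>I. p < q")
  case True
  then obtain p q where pq: "p \<in> I" "q \<in> I" "p < q" by blast
  have on_line: "(q - p) * h t = (q - t) * h p + (t - p) * h q" if "t \<in> I" for t
  proof -
    consider "t = p" | "t = q" | "t < p" | "p < t" "t < q" | "q < t" by linarith
    then show ?thesis
      using pq that three[of t p q] three[of p t q] three[of p q t]
      by cases (simp_all add: algebra_simps)
  qed
  have "(q - p) * h t = (h q - h p) * t + (q * h p - p * h q)" if "t \<in> I" for t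
    using on_line[OF that] by (simp add: algebra_simps)
  then have "h t = ((h q - h p) * t + (q * h p - p * h q)) / (q - p)" if "t \<in> I" for t
    using that pq(3) by (simp add: eq_divide_eq mult.commute)
  then have "h t = (h q - h p) / (q - p) * t + (q * h p - p * h q) / (q - p)" if "t \<in> I" for t
    using that by (simp add: add_divide_distrib)
  then show ?thesis by blast
next
  case False
  show ?thesis
  proof (cases "I = {}")
    case False
    then obtain p where "p \<in> I" by blast
    then have "h t = 0 * t + h p" if "t \<in> I" for t
      using that \<open>\<not> (\<exists>p\<in>I. \<exists>q\<in>I. p < q)\<close> by (metis add_0 linorder_neqE mult_zero_left)
    then show ?thesis by blast
  qed simp
qed

text \<open>Strict convexity forces \<open>w = c *\<^sub>R v\<close>, and equality then reads
  \<open>\<bar>1 + c\<bar> = 1 + \<bar>c\<bar>\<close>, which excludes negative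
  \<open>c\<close>.\<close>

lemma strictly_convex_equality:
  fixes N :: "'v::real_vector \<Rightarrow> real"
  assumes norm: "normed_space_on V N" and sc: "strictly_convex_norm_on V N"
    and vw: "v \<in> V" "w \<in> V" and eq: "N (v + w) = N v + N w" and pos: "N v > 0" "N w > 0"
  shows "N w *\<^sub>R v = N v *\<^sub>R w"
proof -
  have scale: "N (c *\<^sub>R u) = \<bar>c\<bar> * N u" if "u \<in> V" for c u
    using norm that unfolding normed_space_on_def by blast
  obtain a b where ab: "a *\<^sub>R v + b *\<^sub>R w = 0" "\<not> (a = 0 \<and> b = 0)"
    using sc vw eq unfolding strictly_convex_norm_on_def by (metis less_irrefl)
  have "N 0 = 0" using scale[OF vw(1), of 0] by simp
  then have nz: "v \<noteq> 0" "w \<noteq> 0" using pos by auto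
  have "b \<noteq> 0" using ab nz by auto
  define c where "c = - a / b"
  have "b *\<^sub>R w = (- a) *\<^sub>R v" using ab(1) by (simp add: add_eq_0_iff)
  then have "(1 / b) *\<^sub>R (b *\<^sub>R w) = (1 / b) *\<^sub>R ((- a) *\<^sub>R v)" by (rule arg_cong)
  then have w: "w = c *\<^sub>R v" using \<open>b \<noteq> 0\<close> by (simp add: c_def)
  have "N (v + w) = \<bar>1 + c\<bar> * N v" using scale[OF vw(1), of "1 + c"] by (simp add: w algebra_simps)
  moreover have Nw: "N w = \<bar>c\<bar> * N v" using scale[OF vw(1)] by (simp add: w)
  ultimately have "\<bar>1 + c\<bar> * N v = (1 + \<bar>c\<bar>) * N v" using eq by (simp add: distrib_right)
  then have "\<bar>1 + c\<bar> = 1 + \<bar>c\<bar>" using pos by simp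
  then have "c \<ge> 0" by linarith
  then show ?thesis unfolding Nw by (simp add: w mult.commute)
qed

text \<open>A linear functional with value \<open>1\<close> on \<open>g x - g y\<close> separates
  the two points. Along a geodesic the norms of successive differences add up, so these are
  proportional to the parameter increments.\<close>

lemma affine_separates_points_of_convex_subset:
  fixes V :: "'v::real_vector set"
  assumes norm: "normed_space_on V N" and sc: "strictly_convex_norm_on V N"
    and iso: "isometric_to_convex_subset TYPE('a::metric_space) V N"
  shows "affine_separates_points TYPE('a)"
  unfolding affine_separates_points_def
proof (intro allI impI)
  fix x y :: 'a assume "x \<noteq> y"
  obtain g :: "'a \<Rightarrow> 'v" where gV: "\<And>x. g x \<in> V" and dist: "\<And>x y. N (g x - g y) = dist x y"
    using iso unfolding isometric_to_convex_subset_def by blast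
  have sub: "subspace V" using norm unfolding normed_space_on_def by blast
  have "N 0 = 0" using norm subspace_0[OF sub] unfolding normed_space_on_def by blast
  with \<open>x \<noteq> y\<close> dist[of x y] have "g x - g y \<noteq> 0" by auto
  then have "independent {g x - g y}" by simp
  then obtain l :: "'v \<Rightarrow> real" where l: "linear l" "l (g x - g y) = 1"
    using linear_independent_extend[of "{g x - g y}" "\<lambda>_. 1::real"] by auto
  have "affine_fun (\<lambda>z. l (g z))"
    unfolding affine_fun_def
  proof (intro allI impI affine_on_of_three_points)
    fix I and \<gamma> :: "real \<Rightarrow> 'a" and r s t
    assume \<gamma>: "geodesic_on I \<gamma>" and I: "r \<in> I" "s \<in> I" "t \<in> I" and less: "r < s" "s < t"
    define v where "v = g (\<gamma> s) - g (\<gamma> r)"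
    define w where "w = g (\<gamma> t) - g (\<gamma> s)"
    have vw: "v \<in> V" "w \<in> V" using subspace_diff[OF sub] gV by (auto simp: v_def w_def)
    have Nv: "N v = s - r" and Nw: "N w = t - s"
      using geodesic_onD[OF \<gamma>] I less by (simp_all add: v_def w_def dist)
    have "v + w = g (\<gamma> t) - g (\<gamma> r)" by (simp add: v_def w_def)
    then have "N (v + w) = N v + N w"
      using geodesic_onD[OF \<gamma>] I less unfolding Nv Nw by (simp add: dist)
    then have "N w *\<^sub>R v = N v *\<^sub>R w"
      using strictly_convex_equality[OF norm sc vw] Nv Nw less by simp
    then have "l ((t - s) *\<^sub>R v) = l ((s - r) *\<^sub>R w)" unfolding Nv Nw by (rule arg_cong)
    then have "(t - s) * (l (g (\<gamma> s)) - l (g (\<gamma> r))) = (s - r) * (l (g (\<gamma> t)) - l (g (\<gamma> s)))"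
      by (simp add: v_def w_def linear_scale[OF l(1)] linear_diff[OF l(1)])
    then show "(t - r) * l (g (\<gamma> s)) = (t - s) * l (g (\<gamma> r)) + (s - r) * l (g (\<gamma> t))"
      by (simp add: algebra_simps)
  qed
  moreover have "l (g x) \<noteq> l (g y)" using l(2) by (simp add: linear_diff[OF l(1)])
  ultimately show "\<exists>f. affine_fun f \<and> f x \<noteq> f y" by blast
qed

text \<open>HOL formulas do not quantify over types, so the first implication names the free vector
  space on \<open>'a\<close> as ambient space, while the second allows any
  \<open>'v\<close>.\<close>

theorem theorem1p1:
  assumes "geodesic_space TYPE('a::metric_space)"
  shows "(affine_separates_points TYPE('a) \<longrightarrow>
            (\<exists>(V :: ('a, real) poly_mapping set) N. normed_space_on V N \<and> strictly_convex_norm_on V N \<and>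
               isometric_to_convex_subset TYPE('a) V N))
       \<and> ((\<exists>(V :: 'v::real_vector set) N. normed_space_on V N \<and> strictly_convex_norm_on V N \<and>
               isometric_to_convex_subset TYPE('a) V N)
            \<longrightarrow> affine_separates_points TYPE('a))"
proof (intro conjI impI)
  assume "affine_separates_points TYPE('a)"
  then obtain g :: "'a \<Rightarrow> ('a, real) poly_mapping" where g: "segment_embedding g" "0 \<in> range g"
    using segment_embedding_exists[OF assms] by blast
  interpret segment_embedding g by (rule g(1))
  show "\<exists>(V :: ('a, real) poly_mapping set) N. normed_space_on V N \<and> strictly_convex_norm_on V N \<and>
      isometric_to_convex_subset TYPE('a) V N"
    using normed_space_on_directions strictly_convex_directions
      isometric_to_convex_subset_directions[OF g(2)] by blast
next
  assume "\<exists>(V :: 'v::real_vector set) N. normed_space_on V N \<and> strictly_convex_norm_on V N \<and>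
      isometric_to_convex_subset TYPE('a) V N"
  then show "affine_separates_points TYPE('a)"
    using affine_separates_points_of_convex_subset by blast
qed

end
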